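(* Let $g\in\mathcal G$, let $\nu(g)=\mathrm E[g(U)]$ with $U\sim\mathcal U[0,1]$, and let $$\widehat m_0(p_1,\dots,p_m)=\frac1{\nu(g)}\Big(1+\sum_{i=1}^m g(p_i)\Big).$$ Define the (conditional) mean estimator $$\widehat m_0^{\mathrm{mean}}(p_1,\dots,p_m)=\frac1{\nu(g)}\Big(1+\sum_{i=1}^m \bar g_{F_i}(p_i)\Big),$$ where each $\bar g_{F_i}$ is the step function associated with $g$ and $F_i$ defined in the context. Then the plug-in BH procedure using $\widehat m_0^{\mathrm{mean}}$ controls the FDR at level $\alpha$, and $\widehat m_0^{\mathrm{mean}}\le\widehat m_0$ almost surely.
   Context: Setting: an observation $X$ has distribution $P$ belonging to a set $\mathcal P$ of possible distributions. There are $m$ null hypotheses $H_{0,1},\dots,H_{0,m}$ on $P$; $\mathcal H_0(P)\subseteq\{1,\dots,m\}$ is the set of indices $i$ such that $H_{0,i}$ is satisfied by $P$. The $p$-values are $[0,1]$-valued random variables $p_i=p_i(X)$. The (maximum) null cumulative distribution function of $p_i$ is $F_i(t)=\sup_{P\in\mathcal P:\, i\in\mathcal H_0(P)}\mathbf P_{X\sim P}(p_i(X)\le t)$, $t\in[0,1]$. Standing assumptions: (i) the $p$-values $p_1,\dots,p_m$ are mutually independent in the model $\mathcal P$; (ii) discreteness: for each $i$ there is a finite support $\mathcal S_i\subset[0,1]$ such that $F_i$ is a right-continuous step function that jumps only at some points of $\mathcal S_i$; (iii) super-uniformity: $F_i(t)\le t$ for all $t\in[0,1]$ and all $i$; (iv)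 $F_1,\dots,F_m$ are known. $\mathcal U[0,1]$ is the uniform distribution on $[0,1]$. $\mathcal G$ is the set of all non-decreasing functions $g:[0,1]\to[0,1]$ with $\mathrm E[g(U)]>0$ for $U\sim\mathcal U[0,1]$. For a discrete super-uniform distribution function $F$ on $[0,1]$, with support written $\mathcal S=\{0<s_1<s_2<\dots<s_L=1\}$ and $s_0:=0$, and for $g\in\mathcal G$, define $$\bar g_F(t)=\sum_{k=1}^L a_k\,\mathbf 1_{(s_{k-1},s_k]}(t),\qquad a_k=\frac{1}{F(s_k)-F(s_{k-1})}\int_{F(s_{k-1})}^{F(s_k)}g(s)\,ds.$$ Plug-in BH procedure at level $\alpha$ with estimator $\widehat m=\widehat m(p_1,\dots,p_m)$: let $p_{(1)}\le\dots\le p_{(m)}$ be the ordered $p$-values with corresponding null hypotheses $H_{(1)},\dots,H_{(m)}$, and $p_{(0)}:=0$; reject $H_{(1)},\dots,H_{(\hat k)}$, where $\hat k=\max\{\ell\in\{0,\dots,m\}: p_{(\ell)}\le \ell\alpha/\widehat m\}$. The FDR is the expected proportion of errors (rejected true null hypotheses) among the rejections (the proportion being $0$ if there are no rejections). Controlling the FDR at level $\alpha$ means that it is at most $\alpha$.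
   Formalization: It is assumed that each p-value p_i lies almost surely in its finite support S_i under every P in the model (otherwise the almost-sure inequality can fail), and where F_i does not jump at s_k the undefined 0/0 average a_k is read as g(F_i(s_k)). *)

theory Defs
  imports "HOL-Probability.Probability"
begin

text \<open>The uniform distribution as a measure on the space [0,1] itself, so that the values
  of a function g outside [0,1] play no role (not even for measurability).\<close>

definition uniform01 :: "real measure" where
  "uniform01 = restrict_space lborel {0..1}"

definition nu :: "(real \<Rightarrow> real) \<Rightarrow> real" where
  "nu g = (\<integral>u. g u \<partial>uniform01)"

definition G_class :: "(real \<Rightarrow> real) set" where
  "G_class = {g. mono_on {0..1} g \<and> g ` {0..1} \<subseteq> {0..1} \<and> nu g > 0}"

text \<open>The hypotheses are sets of distributions; the observation X is the identity on the
  observation space, so that its law is P.\<close>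

definition true_nulls :: "nat \<Rightarrow> (nat \<Rightarrow> 'x measure set) \<Rightarrow> 'x measure \<Rightarrow> nat set" where
  "true_nulls m H P = {i \<in> {1..m}. P \<in> H i}"

text \<open>The supremum is taken in the complete lattice of extended nonnegative reals, so it is 0 if
  no distribution of the model satisfies the hypothesis.\<close>

definition null_cdf ::
  "nat \<Rightarrow> 'x measure set \<Rightarrow> (nat \<Rightarrow> 'x measure set) \<Rightarrow> (nat \<Rightarrow> 'x \<Rightarrow> real) \<Rightarrow> nat \<Rightarrow> real \<Rightarrow> real" where
  "null_cdf m \<P> H p i t =
     enn2real (SUP P \<in> {P \<in> \<P>. i \<in> true_nulls m H P}. emeasure P {x \<in> space P. p i x \<le> t})"

definition right_cont_step_on :: "real set \<Rightarrow> (real \<Rightarrow> real) \<Rightarrow> bool" where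
  "right_cont_step_on S F \<longleftrightarrow>
     (\<forall>t\<in>{0..<1}. continuous (at_right t) F) \<and>
     (\<forall>I. is_interval I \<and> I \<subseteq> {0..1} - S \<longrightarrow> F constant_on I)"

text \<open>The points 0 = s_0 < s_1 < ... < s_L, where s_1, ..., s_L enumerate the support.\<close>

definition supp_pt :: "real set \<Rightarrow> nat \<Rightarrow> real" where
  "supp_pt S k = (0 # sorted_list_of_set (S - {0})) ! k"

text \<open>The quotient defining a_k is 0/0 if F does not jump at the support point s_k.  The average of
  g over the one-point interval from F(s_k) to F(s_k) is then read as g(F(s_k)), and not as 0,
  which is what division by zero would give.\<close>

definition cell_avg :: "(real \<Rightarrow> real) \<Rightarrow> real set \<Rightarrow> (real \<Rightarrow> real) \<Rightarrow> nat \<Rightarrow> real" where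
  "cell_avg g S F k =
     (let a = F (supp_pt S (k - 1)); b = F (supp_pt S k) in
      if a = b then g b else (1 / (b - a)) * (LINT u:{a..b}|lborel. g u))"

definition g_bar :: "(real \<Rightarrow> real) \<Rightarrow> real set \<Rightarrow> (real \<Rightarrow> real) \<Rightarrow> real \<Rightarrow> real" where
  "g_bar g S F t =
     (\<Sum>k = 1..card (S - {0}). cell_avg g S F k * indicator {supp_pt S (k - 1) <.. supp_pt S k} t)"

definition m0_hat :: "nat \<Rightarrow> (real \<Rightarrow> real) \<Rightarrow> (nat \<Rightarrow> real) \<Rightarrow> real" where
  "m0_hat m g q = (1 / nu g) * (1 + (\<Sum>i = 1..m. g (q i)))"

definition m0_hat_mean ::
  "nat \<Rightarrow> (real \<Rightarrow> real) \<Rightarrow> (nat \<Rightarrow> real set) \<Rightarrow> (nat \<Rightarrow> real \<Rightarrow> real) \<Rightarrow> (nat \<Rightarrow> real) \<Rightarrow> real" where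
  "m0_hat_mean m g S F q = (1 / nu g) * (1 + (\<Sum>i = 1..m. g_bar g (S i) (F i) (q i)))"

text \<open>The indices 1, ..., m in the order of increasing p-values.  Ties are broken by index, which
  does not affect the BH rejection set.\<close>

definition pval_order :: "nat \<Rightarrow> (nat \<Rightarrow> real) \<Rightarrow> nat list" where
  "pval_order m q = sort_key q [1..<Suc m]"

definition ordered_pval :: "nat \<Rightarrow> (nat \<Rightarrow> real) \<Rightarrow> nat \<Rightarrow> real" where
  "ordered_pval m q l = (0 # map q (pval_order m q)) ! l"

definition BH_count :: "nat \<Rightarrow> real \<Rightarrow> ((nat \<Rightarrow> real) \<Rightarrow> real) \<Rightarrow> (nat \<Rightarrow> real) \<Rightarrow> nat" where
  "BH_count m \<alpha> mhat q = Max {l \<in> {0..m}. ordered_pval m q l \<le> real l * \<alpha> / mhat q}"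

definition plug_in_BH :: "nat \<Rightarrow> real \<Rightarrow> ((nat \<Rightarrow> real) \<Rightarrow> real) \<Rightarrow> (nat \<Rightarrow> real) \<Rightarrow> nat set" where
  "plug_in_BH m \<alpha> mhat q = set (take (BH_count m \<alpha> mhat q) (pval_order m q))"

text \<open>Division by zero makes the proportion 0 if there are no rejections.\<close>

definition FDP :: "nat set \<Rightarrow> nat set \<Rightarrow> real" where
  "FDP H0 R = real (card (R \<inter> H0)) / real (card R)"

definition FDR ::
  "nat \<Rightarrow> (nat \<Rightarrow> 'x measure set) \<Rightarrow> (nat \<Rightarrow> 'x \<Rightarrow> real) \<Rightarrow> ((nat \<Rightarrow> real) \<Rightarrow> nat set) \<Rightarrow> 'x measure \<Rightarrow> real" where
  "FDR m H p proc P = (\<integral>x. FDP (true_nulls m H P) (proc (\<lambda>i. p i x)) \<partial>P)"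

end

theory Submission
  imports Defs
begin

text \<open>All p-values lie almost surely in finite sets, so every expectation is a finite sum over a
  product of supports.  Fix a true null hypothesis \<open>i\<close> and all p-values but the \<open>i\<close>-th.  The estimator
  is at least \<open>(1 + \<Sum>j. Y j) / \<nu>\<close>, where \<open>j\<close> ranges over the other true nulls and \<open>Y j\<close> is the step
  function of the \<open>j\<close>-th p-value, and the number of rejections does not increase with the \<open>i\<close>-th
  p-value.  By super-uniformity, the \<open>i\<close>-th hypothesis therefore contributes at most
  \<open>\<alpha> \<nu> E[1 / (1 + \<Sum>j. Y j)]\<close> to the FDR.  Since \<open>\<nu> \<le> E[Y i]\<close> and \<open>0 \<le> Y i \<le> 1\<close>, independence
  bounds this by \<open>\<alpha>\<close> times the expected share of \<open>Y i\<close> in the sum of \<open>Y\<close> over all true nulls, and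
  the shares add up to at most 1.\<close>

section \<open>Rejection counts\<close>

text \<open>The entries of a sorted list that are at most \<open>c\<close> form an initial segment,
  and the filter keeps exactly this segment.\<close>

lemma sorted_nth_le_iff_filter:
  fixes xs :: "'a::linorder list"
  shows "sorted xs \<Longrightarrow> n < length xs \<Longrightarrow> xs ! n \<le> c \<longleftrightarrow> n < length (filter (\<lambda>y. y \<le> c) xs)"
proof (induction xs arbitrary: n)
  case (Cons x xs)
  show ?case
  proof (cases "x \<le> c")
    case True
    then show ?thesis using Cons by (cases n) auto
  next
    case False
    then have *: "filter (\<lambda>y. y \<le> c) (x # xs) = []"
      using Cons.prems(1) by (auto simp: filter_empty_conv)
    have "x \<le> (x # xs) ! n"
      using Cons.prems by (cases n) auto
    with False * show ?thesis by auto
  qed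
qed simp

lemma pval_order_simps:
  "sorted (map q (pval_order m q))" "distinct (pval_order m q)"
  "length (pval_order m q) = m" "set (pval_order m q) = {1..m}"
  by (auto simp: pval_order_def simp del: upt_Suc)

lemma ordered_pval_le_iff:
  assumes "1 \<le> l" "l \<le> m"
  shows "ordered_pval m q l \<le> c \<longleftrightarrow> l \<le> card {j \<in> {1..m}. q j \<le> c}"
proof -
  obtain n where n: "l = Suc n" using assms(1) by (cases l) auto
  have "ordered_pval m q l \<le> c \<longleftrightarrow> map q (pval_order m q) ! n \<le> c"
    by (simp add: ordered_pval_def n)
  also have "\<dots> \<longleftrightarrow> n < length (filter (\<lambda>y. y \<le> c) (map q (pval_order m q)))"
    by (rule sorted_nth_le_iff_filter) (use assms n in \<open>simp_all add: pval_order_simps\<close>)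
  also have "length (filter (\<lambda>y. y \<le> c) (map q (pval_order m q))) = card {j \<in> {1..m}. q j \<le> c}"
    by (simp add: filter_map distinct_length_filter pval_order_simps Int_def conj_commute)
  finally show ?thesis by (simp add: n Suc_le_eq)
qed

text \<open>Counting the p-values below a threshold replaces the order statistics, so that
  monotonicity in \<open>q\<close> becomes a matter of set inclusion.\<close>

lemma BH_count_eq:
  "BH_count m \<alpha> mhat q = Max {l \<in> {0..m}. l \<le> card {j \<in> {1..m}. q j \<le> real l * \<alpha> / mhat q}}"
proof -
  have "ordered_pval m q l \<le> real l * \<alpha> / mhat q \<longleftrightarrow> l \<le> card {j \<in> {1..m}. q j \<le> real l * \<alpha> / mhat q}"
    if "l \<le> m" for l
  proof (cases "l = 0")
    \<comment> \<open>For \<open>l = 0\<close> both sides hold: the prepended value and the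
      threshold are 0, whatever \<open>mhat q\<close> is.\<close>
    case True
    then show ?thesis by (simp add: ordered_pval_def)
  next
    case False
    then show ?thesis using that ordered_pval_le_iff[of l m] by simp
  qed
  then show ?thesis
    unfolding BH_count_def by (intro arg_cong[where f=Max]) auto
qed

lemma BH_count_cong:
  assumes "mhat q = mhat q'" "\<And>j. j \<in> {1..m} \<Longrightarrow> q j = q' j"
  shows "BH_count m \<alpha> mhat q = BH_count m \<alpha> mhat q'"
proof -
  have "{j \<in> {1..m}. q j \<le> c} = {j \<in> {1..m}. q' j \<le> c}" for c
    using assms(2) by auto
  then show ?thesis
    unfolding BH_count_eq assms(1) by presburger
qed

text \<open>A larger estimate cannot raise any threshold, and larger p-values cannot enlarge any
  counted set, so no new \<open>l\<close> becomes admissible.\<close>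

lemma BH_count_antimono:
  assumes "0 \<le> \<alpha>" "0 < mhat q" "mhat q \<le> mhat q'" "\<And>j. j \<in> {1..m} \<Longrightarrow> q j \<le> q' j"
  shows "BH_count m \<alpha> mhat q' \<le> BH_count m \<alpha> mhat q"
  unfolding BH_count_eq
proof (rule Max_mono)
  show "{l \<in> {0..m}. l \<le> card {j \<in> {1..m}. q' j \<le> real l * \<alpha> / mhat q'}}
      \<subseteq> {l \<in> {0..m}. l \<le> card {j \<in> {1..m}. q j \<le> real l * \<alpha> / mhat q}}"
  proof safe
    fix l assume l: "l \<le> card {j \<in> {1..m}. q' j \<le> real l * \<alpha> / mhat q'}"
    have "real l * \<alpha> / mhat q' \<le> real l * \<alpha> / mhat q"
      using assms by (intro divide_left_mono mult_pos_pos mult_nonneg_nonneg) auto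
    then have "{j \<in> {1..m}. q' j \<le> real l * \<alpha> / mhat q'} \<subseteq> {j \<in> {1..m}. q j \<le> real l * \<alpha> / mhat q}"
      using assms(4) by force
    then have "card {j \<in> {1..m}. q' j \<le> real l * \<alpha> / mhat q'} \<le> card {j \<in> {1..m}. q j \<le> real l * \<alpha> / mhat q}"
      by (intro card_mono) auto
    with l show "l \<le> card {j \<in> {1..m}. q j \<le> real l * \<alpha> / mhat q}" by simp
  qed
qed auto

lemma BH_count_mem:
  "BH_count m \<alpha> mhat q \<in> {l \<in> {0..m}. ordered_pval m q l \<le> real l * \<alpha> / mhat q}"
  unfolding BH_count_def
  by (rule Max_in) (auto simp: ordered_pval_def intro!: exI[of _ 0])

lemma plug_in_BH_threshold:
  assumes "i \<in> plug_in_BH m \<alpha> mhat q"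
  shows "q i \<le> real (BH_count m \<alpha> mhat q) * \<alpha> / mhat q"
proof -
  define k where "k = BH_count m \<alpha> mhat q"
  have k: "k \<le> m" "ordered_pval m q k \<le> real k * \<alpha> / mhat q"
    using BH_count_mem[of m \<alpha> mhat q] by (auto simp: k_def)
  \<comment> \<open>Positions in \<open>pval_order\<close> start at 0, so the \<open>k\<close>-th
    ordered p-value stands at position \<open>k - 1\<close>, which is not before
    \<open>n\<close>.\<close>
  obtain n where n: "n < k" "i = pval_order m q ! n"
    using assms k(1) by (auto simp: plug_in_BH_def k_def[symmetric] in_set_conv_nth pval_order_simps)
  have "map q (pval_order m q) ! n \<le> map q (pval_order m q) ! (k - 1)"
    using n k(1) by (intro sorted_nth_mono) (auto simp: pval_order_simps)
  also have "\<dots> = ordered_pval m q k"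
    using n k(1) by (cases k) (auto simp: ordered_pval_def)
  finally show ?thesis
    using n k by (simp add: pval_order_simps k_def)
qed

lemma card_plug_in_BH: "card (plug_in_BH m \<alpha> mhat q) = BH_count m \<alpha> mhat q"
  using BH_count_mem[of m \<alpha> mhat q]
  by (simp add: plug_in_BH_def distinct_card pval_order_simps)

text \<open>The proportion is split over the true nulls, and each rejection is relaxed to its
  threshold condition. If nothing is rejected, all terms are 0 because
  \<open>1 / 0 = 0\<close>.\<close>

lemma FDP_plug_in_BH_le:
  assumes "finite N"
  shows "FDP N (plug_in_BH m \<alpha> mhat q)
    \<le> (\<Sum>i\<in>N. if q i \<le> real (BH_count m \<alpha> mhat q) * \<alpha> / mhat q then 1 / real (BH_count m \<alpha> mhat q) else 0)"
proof -
  let ?R = "plug_in_BH m \<alpha> mhat q" and ?k = "BH_count m \<alpha> mhat q"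
  have "FDP N ?R = (\<Sum>i\<in>?R \<inter> N. 1 / real ?k)"
    by (simp add: FDP_def card_plug_in_BH)
  also have "\<dots> = (\<Sum>i\<in>N. if i \<in> ?R then 1 / real ?k else 0)"
    using assms by (simp add: Int_commute flip: sum.inter_restrict)
  also have "\<dots> \<le> (\<Sum>i\<in>N. if q i \<le> real ?k * \<alpha> / mhat q then 1 / real ?k else 0)"
    by (intro sum_mono) (auto dest: plug_in_BH_threshold)
  finally show ?thesis .
qed

section \<open>Finite product distributions\<close>

text \<open>For probability weights this is the expectation of \<open>h\<close> when the coordinates
  are independent.\<close>

definition prod_mean :: "'i set \<Rightarrow> ('i \<Rightarrow> 'a set) \<Rightarrow> ('i \<Rightarrow> 'a \<Rightarrow> real) \<Rightarrow> (('i \<Rightarrow> 'a) \<Rightarrow> real) \<Rightarrow> real" where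
  "prod_mean I S w h = (\<Sum>q\<in>PiE I S. (\<Prod>i\<in>I. w i (q i)) * h q)"

lemma prod_mean_mono:
  assumes "\<And>i s. i \<in> I \<Longrightarrow> s \<in> S i \<Longrightarrow> 0 \<le> w i s"
    and "\<And>q. q \<in> PiE I S \<Longrightarrow> h q \<le> h' q"
  shows "prod_mean I S w h \<le> prod_mean I S w h'"
  unfolding prod_mean_def using assms
  by (intro sum_mono mult_left_mono prod_nonneg) (auto simp: PiE_iff)

lemma prod_mean_const:
  assumes "finite I" "\<And>i. i \<in> I \<Longrightarrow> finite (S i)" "\<And>i. i \<in> I \<Longrightarrow> (\<Sum>s\<in>S i. w i s) = 1"
  shows "prod_mean I S w (\<lambda>_. c) = c"
proof -
  have "(\<Sum>q\<in>PiE I S. \<Prod>i\<in>I. w i (q i)) = (\<Prod>i\<in>I. \<Sum>s\<in>S i. w i s)"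
    using assms by (intro prod_sum_PiE[symmetric])
  then show ?thesis
    using assms by (simp add: prod_mean_def flip: sum_distrib_right)
qed

lemma prod_mean_sum:
  "prod_mean I S w (\<lambda>q. \<Sum>i\<in>N. h i q) = (\<Sum>i\<in>N. prod_mean I S w (h i))"
  unfolding prod_mean_def sum_distrib_left by (rule sum.swap)

text \<open>Fubini for finite products: coordinate \<open>i\<close> is averaged first, with the
  others fixed.\<close>

lemma prod_mean_insert:
  assumes "finite J" "i \<notin> J"
  shows "prod_mean (insert i J) S w h = prod_mean J S w (\<lambda>q. \<Sum>s\<in>S i. w i s * h (q(i := s)))"
proof -
  have inj: "inj_on (\<lambda>(y, q). q(i := y)) (S i \<times> PiE J S)"
    using inj_combinator[OF assms(2), of S] by simp
  have "prod_mean (insert i J) S w h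
     = (\<Sum>(s, q)\<in>S i \<times> PiE J S. (\<Prod>j\<in>insert i J. w j ((q(i := s)) j)) * h (q(i := s)))"
    unfolding prod_mean_def PiE_insert_eq sum.reindex[OF inj]
    by (simp add: case_prod_unfold)
  also have "\<dots> = (\<Sum>s\<in>S i. \<Sum>q\<in>PiE J S. (\<Prod>j\<in>insert i J. w j ((q(i := s)) j)) * h (q(i := s)))"
    by (simp add: sum.cartesian_product)
  also have "\<dots> = (\<Sum>q\<in>PiE J S. \<Sum>s\<in>S i. (\<Prod>j\<in>insert i J. w j ((q(i := s)) j)) * h (q(i := s)))"
    by (rule sum.swap)
  also have "\<dots> = prod_mean J S w (\<lambda>q. \<Sum>s\<in>S i. w i s * h (q(i := s)))"
  proof -
    have "(\<Prod>j\<in>insert i J. w j ((q(i := s)) j)) = w i s * (\<Prod>j\<in>J. w j (q j))" for q s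
    proof -
      have "(\<Prod>j\<in>J. w j ((q(i := s)) j)) = (\<Prod>j\<in>J. w j (q j))"
        using assms by (intro prod.cong) auto
      then show ?thesis using assms by simp
    qed
    then show ?thesis
      by (simp add: prod_mean_def sum_distrib_left mult_ac)
  qed
  finally show ?thesis .
qed

text \<open>Let \<open>t\<close> be the largest contributing point. Since \<open>h\<close> is
  non-increasing, each factor \<open>1 / h s\<close> is at most \<open>1 / h t\<close>; the mass up
  to \<open>t\<close> is at most \<open>t\<close>, and \<open>t \<le> c * h t\<close>.\<close>

lemma superuniform_threshold_bound:
  fixes w :: "real \<Rightarrow> real" and h :: "real \<Rightarrow> nat"
  assumes fin: "finite S" "S \<subseteq> {0..1}" and w: "\<And>s. s \<in> S \<Longrightarrow> 0 \<le> w s"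
    and su: "\<And>t. t \<in> {0..1} \<Longrightarrow> (\<Sum>s\<in>{s\<in>S. s \<le> t}. w s) \<le> t"
    and h: "\<And>s t. s \<in> S \<Longrightarrow> t \<in> S \<Longrightarrow> s \<le> t \<Longrightarrow> h t \<le> h s"
    and c: "0 \<le> c"
  shows "(\<Sum>s\<in>S. w s * (if s \<le> c * real (h s) then 1 / real (h s) else 0)) \<le> c"
proof -
  \<comment> \<open>Points with \<open>h s = 0\<close> drop out, as their quotient is 0.\<close>
  define A where "A = {s \<in> S. s \<le> c * real (h s) \<and> 0 < h s}"
  have fA: "finite A" using fin by (simp add: A_def)
  have eq: "(\<Sum>s\<in>S. w s * (if s \<le> c * real (h s) then 1 / real (h s) else 0)) = (\<Sum>s\<in>A. w s * (1 / real (h s)))"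
    using fin by (intro sum.mono_neutral_cong_right) (auto simp: A_def)
  show ?thesis
  proof (cases "A = {}")
    case True
    then show ?thesis using eq c by simp
  next
    case False
    define t where "t = Max A"
    have t: "t \<in> A" using False fA by (simp add: t_def)
    then have tS: "t \<in> S" "t \<le> c * real (h t)" "0 < h t" by (auto simp: A_def)
    have le: "s \<le> t" if "s \<in> A" for s using that fA by (simp add: t_def)
    have "(\<Sum>s\<in>A. w s * (1 / real (h s))) \<le> (\<Sum>s\<in>A. w s * (1 / real (h t)))"
      using le tS h w by (intro sum_mono mult_left_mono divide_left_mono) (auto simp: A_def)
    also have "\<dots> \<le> (\<Sum>s\<in>{s\<in>S. s \<le> t}. w s * (1 / real (h t)))"
      using fin w le by (intro sum_mono2) (auto simp: A_def)
    also have "\<dots> = (\<Sum>s\<in>{s\<in>S. s \<le> t}. w s) / real (h t)"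
      by (simp add: sum_divide_distrib)
    also have "\<dots> \<le> t / real (h t)"
      using su[of t] tS fin by (intro divide_right_mono) auto
    also have "\<dots> \<le> c" using tS by (simp add: field_simps)
    finally show ?thesis using eq by simp
  qed
qed

text \<open>Here \<open>R\<close> and \<open>\<mu>\<close> stand for the rejection count and the
  estimator. Of the count only its monotonicity in each null coordinate enters, so the FDR bound
  becomes a statement about finite sums.\<close>

lemma prod_mean_plug_in_le:
  fixes S :: "'i \<Rightarrow> real set" and w Y :: "'i \<Rightarrow> real \<Rightarrow> real"
    and R :: "('i \<Rightarrow> real) \<Rightarrow> nat" and \<mu> :: "('i \<Rightarrow> real) \<Rightarrow> real"
  assumes I: "finite I" "N \<subseteq> I"
    and S: "\<And>i. i \<in> I \<Longrightarrow> finite (S i)" "\<And>i. i \<in> I \<Longrightarrow> S i \<subseteq> {0..1}"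
    and w: "\<And>i s. i \<in> I \<Longrightarrow> s \<in> S i \<Longrightarrow> 0 \<le> w i s" "\<And>i. i \<in> I \<Longrightarrow> (\<Sum>s\<in>S i. w i s) = 1"
    and su: "\<And>i t. i \<in> N \<Longrightarrow> t \<in> {0..1} \<Longrightarrow> (\<Sum>s\<in>{s\<in>S i. s \<le> t}. w i s) \<le> t"
    and Y: "\<And>i s. i \<in> I \<Longrightarrow> s \<in> S i \<Longrightarrow> 0 \<le> Y i s" "\<And>i s. i \<in> I \<Longrightarrow> s \<in> S i \<Longrightarrow> Y i s \<le> 1"
    and Y_mean: "\<And>i. i \<in> N \<Longrightarrow> \<nu> \<le> (\<Sum>s\<in>S i. w i s * Y i s)"
    and \<nu>: "0 < \<nu>" and \<alpha>: "0 \<le> \<alpha>"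
    and \<mu>: "\<And>q. q \<in> PiE I S \<Longrightarrow> \<mu> q = 1 / \<nu> * (1 + (\<Sum>i\<in>I. Y i (q i)))"
    and R: "\<And>q i s t. q \<in> PiE I S \<Longrightarrow> i \<in> N \<Longrightarrow> s \<in> S i \<Longrightarrow> t \<in> S i \<Longrightarrow> s \<le> t
              \<Longrightarrow> R (q(i := t)) \<le> R (q(i := s))"
  shows "prod_mean I S w (\<lambda>q. \<Sum>i\<in>N. if q i \<le> real (R q) * \<alpha> / \<mu> q then 1 / real (R q) else 0) \<le> \<alpha>"
proof -
  have N: "finite N" using I finite_subset by blast
  have "prod_mean I S w (\<lambda>q. if q i \<le> real (R q) * \<alpha> / \<mu> q then 1 / real (R q) else 0)
      \<le> prod_mean I S w (\<lambda>q. \<alpha> * (Y i (q i) / (\<Sum>j\<in>N. Y j (q j))))" if i: "i \<in> N" for i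
  proof -
    define J where "J = I - {i}"
    have J: "finite J" "i \<notin> J" and I_eq: "I = insert i J" using I i by (auto simp: J_def)
    \<comment> \<open>Up to the factor \<open>1 / \<nu>\<close>, \<open>Z\<close> bounds the
      estimator from below without looking at coordinate \<open>i\<close>, so it is constant while
      that coordinate is averaged. The summand 1 keeps it positive.\<close>
    define Z where "Z q = 1 + (\<Sum>j\<in>N - {i}. Y j (q j))" for q
    have Z_upd: "Z (q(i := s)) = Z q" for q s
      unfolding Z_def by (intro arg_cong2[where f="(+)"] sum.cong) auto
    have Z_ge1: "1 \<le> Z q" if "\<And>j. j \<in> N - {i} \<Longrightarrow> q j \<in> S j" for q
      using that I Y(1) unfolding Z_def by (auto simp: subset_iff intro!: sum_nonneg)
    have step1: "(\<Sum>s\<in>S i. w i s * (if (q(i := s)) i \<le> real (R (q(i := s))) * \<alpha> / \<mu> (q(i := s))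
                then 1 / real (R (q(i := s))) else 0))
        \<le> (\<Sum>s\<in>S i. w i s * (\<alpha> * (Y i ((q(i := s)) i) / Z (q(i := s)))))"
      if q: "q \<in> PiE J S" for q
    proof -
      have Z1: "1 \<le> Z q" using q I by (intro Z_ge1) (auto simp: J_def PiE_iff)
      have upd: "q(i := s) \<in> PiE I S" if "s \<in> S i" for s
        using q that by (auto simp: I_eq PiE_iff extensional_def)
      have \<mu>_ge: "Z q / \<nu> \<le> \<mu> (q(i := s))" if "s \<in> S i" for s
      proof -
        have "(\<Sum>j\<in>N - {i}. Y j (q j)) = (\<Sum>j\<in>N - {i}. Y j ((q(i := s)) j))"
          by (intro sum.cong) auto
        also have "\<dots> \<le> (\<Sum>j\<in>I. Y j ((q(i := s)) j))"
          using I upd[OF that] Y(1) by (intro sum_mono2) (auto simp: PiE_iff)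
        finally have "Z q \<le> 1 + (\<Sum>j\<in>I. Y j ((q(i := s)) j))" by (simp add: Z_def)
        then show ?thesis using \<mu>[OF upd[OF that]] \<nu> by (simp add: divide_right_mono)
      qed
      have "(\<Sum>s\<in>S i. w i s * (if (q(i := s)) i \<le> real (R (q(i := s))) * \<alpha> / \<mu> (q(i := s))
                then 1 / real (R (q(i := s))) else 0))
          \<le> (\<Sum>s\<in>S i. w i s * (if s \<le> \<alpha> * \<nu> / Z q * real (R (q(i := s)))
                then 1 / real (R (q(i := s))) else 0))"
      proof (intro sum_mono mult_left_mono)
        fix s assume s: "s \<in> S i"
        have "real (R (q(i := s))) * \<alpha> / \<mu> (q(i := s)) \<le> real (R (q(i := s))) * \<alpha> / (Z q / \<nu>)"
        proof (rule divide_left_mono)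
          have "0 < Z q / \<nu>" using Z1 \<nu> by simp
          with \<mu>_ge[OF s] show "0 < \<mu> (q(i := s)) * (Z q / \<nu>)" by (intro mult_pos_pos) linarith+
        qed (use \<mu>_ge[OF s] \<alpha> in auto)
        then show "(if (q(i := s)) i \<le> real (R (q(i := s))) * \<alpha> / \<mu> (q(i := s))
                then 1 / real (R (q(i := s))) else 0)
            \<le> (if s \<le> \<alpha> * \<nu> / Z q * real (R (q(i := s))) then 1 / real (R (q(i := s))) else 0)"
          by (auto simp: mult_ac)
        show "0 \<le> w i s" using w s i I by auto
      qed
      also have "\<dots> \<le> \<alpha> * \<nu> / Z q"
      proof (rule superuniform_threshold_bound)
        show "R (q(i := t)) \<le> R (q(i := s))" if "s \<in> S i" "t \<in> S i" "s \<le> t" for s t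
          using R[OF upd[OF that(1)] i that] by simp
      qed (use S[OF subsetD[OF I(2) i]] w(1)[OF subsetD[OF I(2) i]] su[OF i] Z1 \<nu> \<alpha> in auto)
      \<comment> \<open>Replacing \<open>\<nu>\<close> by the mean of \<open>Y i\<close> turns the
        constant bound back into an average over coordinate \<open>i\<close>, so that
        \<open>prod_mean_insert\<close> can restore the full product.\<close>
      also have "\<dots> \<le> \<alpha> * (\<Sum>s\<in>S i. w i s * Y i s) / Z q"
        using Y_mean[OF i] \<alpha> Z1 by (intro divide_right_mono mult_left_mono) auto
      also have "\<dots> = (\<Sum>s\<in>S i. w i s * (\<alpha> * (Y i ((q(i := s)) i) / Z (q(i := s)))))"
        by (simp add: Z_upd sum_distrib_left sum_divide_distrib mult_ac)
      finally show ?thesis .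
    qed
    have "prod_mean I S w (\<lambda>q. if q i \<le> real (R q) * \<alpha> / \<mu> q then 1 / real (R q) else 0)
        \<le> prod_mean I S w (\<lambda>q. \<alpha> * (Y i (q i) / Z q))"
      unfolding I_eq prod_mean_insert[OF J]
      by (rule prod_mean_mono) (use w I_eq step1 in auto)
    also have "\<dots> \<le> prod_mean I S w (\<lambda>q. \<alpha> * (Y i (q i) / (\<Sum>j\<in>N. Y j (q j))))"
    proof (intro prod_mean_mono mult_left_mono \<alpha>)
      fix q assume q: "q \<in> PiE I S"
      then have qS: "q j \<in> S j" if "j \<in> I" for j using that by (auto simp: PiE_iff)
      have Yi: "0 \<le> Y i (q i)" "Y i (q i) \<le> 1" using Y qS i I by auto
      have sum_eq: "(\<Sum>j\<in>N. Y j (q j)) = Y i (q i) + (\<Sum>j\<in>N - {i}. Y j (q j))"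
        using N i by (rule sum.remove)
      have nn: "0 \<le> (\<Sum>j\<in>N - {i}. Y j (q j))" using Y(1) qS I by (intro sum_nonneg) auto
      \<comment> \<open>Since \<open>Y i (q i) \<le> 1\<close>, the 1 in \<open>Z\<close> dominates
        the missing summand. The case \<open>Y i (q i) = 0\<close> is separate because the sum over
        \<open>N\<close> may then vanish.\<close>
      show "Y i (q i) / Z q \<le> Y i (q i) / (\<Sum>j\<in>N. Y j (q j))"
      proof (cases "Y i (q i) = 0")
        case False
        then show ?thesis
          using Yi nn by (intro divide_left_mono mult_pos_pos) (auto simp: sum_eq Z_def)
      qed simp
    qed (use w in auto)
    finally show ?thesis .
  qed
  then have "prod_mean I S w (\<lambda>q. \<Sum>i\<in>N. if q i \<le> real (R q) * \<alpha> / \<mu> q then 1 / real (R q) else 0)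
      \<le> prod_mean I S w (\<lambda>q. \<Sum>i\<in>N. \<alpha> * (Y i (q i) / (\<Sum>j\<in>N. Y j (q j))))"
    unfolding prod_mean_sum by (rule sum_mono)
  also have "\<dots> \<le> prod_mean I S w (\<lambda>_. \<alpha>)"
  proof (rule prod_mean_mono)
    fix q
    \<comment> \<open>The shares add up to 1, or to 0 if their denominator is 0.\<close>
    show "(\<Sum>i\<in>N. \<alpha> * (Y i (q i) / (\<Sum>j\<in>N. Y j (q j)))) \<le> \<alpha>"
      using \<alpha> by (simp flip: sum_distrib_left sum_divide_distrib)
  qed (use w in auto)
  also have "\<dots> = \<alpha>" using I S w by (intro prod_mean_const) auto
  finally show ?thesis .
qed

section \<open>Averaging over the cells of a distribution function\<close>

lemma supp_pt_0 [simp]: "supp_pt S 0 = 0"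
  by (simp add: supp_pt_def)

text \<open>Prepending 0 keeps the order strict, since 0 has been removed from the nonnegative set
  \<open>S\<close>.\<close>

lemma supp_pt_less:
  assumes "finite S" "S \<subseteq> {0..}" "j < k" "k \<le> card (S - {0})"
  shows "supp_pt S j < supp_pt S k"
proof -
  have "sorted_wrt (<) (0 # sorted_list_of_set (S - {0}))"
    using assms(1,2) by (auto simp: less_le)
  then show ?thesis
    unfolding supp_pt_def by (rule sorted_wrt_nth_less) (use assms in auto)
qed

lemma supp_pt_le:
  assumes "finite S" "S \<subseteq> {0..}" "j \<le> k" "k \<le> card (S - {0})"
  shows "supp_pt S j \<le> supp_pt S k"
  using supp_pt_less[of S j k] assms by (cases "j = k") auto

lemma bij_betw_supp_pt:
  assumes "finite S"
  shows "bij_betw (supp_pt S) {1..card (S - {0})} (S - {0})"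
proof -
  let ?xs = "sorted_list_of_set (S - {0})"
  have "bij_betw ((!) ?xs) {..<length ?xs} (set ?xs)"
    by (intro bij_betw_nth) auto
  then have "bij_betw ((!) ?xs) {..<card (S - {0})} (S - {0})"
    using assms by simp
  moreover have "bij_betw (\<lambda>k. k - 1) {1..card (S - {0})} {..<card (S - {0})}"
    by (rule bij_betwI[where g=Suc]) auto
  ultimately have "bij_betw ((!) ?xs \<circ> (\<lambda>k. k - 1)) {1..card (S - {0})} (S - {0})"
    by (rule bij_betw_trans[rotated])
  moreover have "((!) ?xs \<circ> (\<lambda>k. k - 1)) k = supp_pt S k" if "k \<in> {1..card (S - {0})}" for k
    using that by (cases k) (auto simp: supp_pt_def)
  ultimately show ?thesis
    using bij_betw_cong[of "{1..card (S - {0})}"] by blast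
qed

lemma supp_pt_nonneg:
  assumes "finite S" "S \<subseteq> {0..}" "k \<le> card (S - {0})"
  shows "0 \<le> supp_pt S k"
  using supp_pt_le[of S 0 k] assms by simp

lemma supp_pt_mem_unit:
  assumes "finite S" "S \<subseteq> {0..1}" "k \<le> card (S - {0})"
  shows "supp_pt S k \<in> {0..1}"
proof (cases "k = 0")
  case False
  then have "supp_pt S k \<in> S - {0}"
    using bij_betwE[OF bij_betw_supp_pt[OF assms(1)]] assms(3) by auto
  with assms(2) show ?thesis by auto
qed simp

text \<open>The cells are disjoint and closed on the right, so the \<open>k\<close>-th support point
  lies in the \<open>k\<close>-th cell only.\<close>

lemma g_bar_supp_pt:
  assumes "finite S" "S \<subseteq> {0..}" "k \<in> {1..card (S - {0})}"
  shows "g_bar g S F (supp_pt S k) = cell_avg g S F k"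
proof -
  have "supp_pt S k \<in> {supp_pt S (j - 1)<..supp_pt S j} \<longleftrightarrow> j = k" if "j \<in> {1..card (S - {0})}" for j
  proof
    assume "supp_pt S k \<in> {supp_pt S (j - 1)<..supp_pt S j}"
    moreover have "j - 1 \<le> card (S - {0})" using that by auto
    ultimately have "\<not> k \<le> j - 1" "\<not> j < k"
      using supp_pt_le[of S k "j - 1"] supp_pt_less[of S j k] assms by auto
    then show "j = k" by simp
  next
    assume "j = k"
    then show "supp_pt S k \<in> {supp_pt S (j - 1)<..supp_pt S j}"
      using supp_pt_less[of S "k - 1" k] assms by auto
  qed
  then have "g_bar g S F (supp_pt S k) = (\<Sum>j = 1..card (S - {0}). if j = k then cell_avg g S F j else 0)"
    unfolding g_bar_def by (intro sum.cong) (auto simp: indicator_def)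
  with assms(3) show ?thesis by simp
qed

text \<open>Every cell excludes its nonnegative left end, hence also 0. The value matters because
  \<open>S\<close> may contain 0.\<close>

lemma g_bar_0:
  assumes "finite S" "S \<subseteq> {0..}"
  shows "g_bar g S F 0 = 0"
  unfolding g_bar_def
proof (intro sum.neutral ballI)
  fix k assume "k \<in> {1..card (S - {0})}"
  then have "0 \<le> supp_pt S (k - 1)"
    using supp_pt_nonneg[OF assms, of "k - 1"] by auto
  then show "cell_avg g S F k * indicator {supp_pt S (k - 1)<..supp_pt S k} 0 = 0"
    by simp
qed

text \<open>A monotone function on a compact interval is Borel measurable there and bounded by its
  values at the endpoints.\<close>

lemma set_integrable_mono_on:
  fixes g :: "real \<Rightarrow> real"
  assumes "mono_on {a..b} g"
  shows "set_integrable lborel {a..b} g"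
proof -
  have meas: "(\<lambda>x. indicator {a..b} x *\<^sub>R g x) \<in> borel_measurable borel"
    using borel_measurable_mono_on_fnc[OF assms]
    by (simp add: borel_measurable_restrict_space_iff)
  have bound: "AE x in lborel. norm (indicator {a..b} x *\<^sub>R g x)
      \<le> norm (indicator {a..b} x *\<^sub>R max \<bar>g a\<bar> \<bar>g b\<bar>)"
  proof (intro AE_I2)
    fix x
    have "g a \<le> g x" "g x \<le> g b" if "a \<le> x" "x \<le> b"
      using that by (auto intro!: mono_onD[OF assms])
    then show "norm (indicator {a..b} x *\<^sub>R g x) \<le> norm (indicator {a..b} x *\<^sub>R max \<bar>g a\<bar> \<bar>g b\<bar>)"
      by (auto simp: indicator_def)
  qed
  have dom: "integrable lborel (\<lambda>x. indicator {a..b} x *\<^sub>R max \<bar>g a\<bar> \<bar>g b\<bar>)"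
    by (intro integrable_real_indicator integrable_scaleR_left) (auto simp: emeasure_lborel_Icc_eq)
  show ?thesis
    unfolding set_integrable_def
    by (rule Bochner_Integration.integrable_bound[OF dom _ bound]) (use meas in simp)
qed

lemma set_integral_mono_on_eq:
  fixes g :: "real \<Rightarrow> real"
  assumes "mono_on {a..b} g"
  shows "(LINT u:{a..b}|lborel. g u) = integral {a..b} g"
  by (rule set_borel_integral_eq_integral set_integrable_mono_on assms)+

text \<open>The gauge integral is additive over adjacent intervals, which is how \<open>nu g\<close>
  is later assembled from the cells.\<close>

lemma nu_eq_integral:
  assumes "mono_on {0..1} g"
  shows "nu g = integral {0..1} g"
  unfolding nu_def uniform01_def
  by (subst integral_restrict_space)
     (simp_all flip: set_integral_mono_on_eq[OF assms] add: set_lebesgue_integral_def)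

text \<open>These properties hold for every null distribution function, whether or not the
  hypothesis is true under the current law. A law of the p-value enters only in
  \<open>nu_le_mean_g_bar\<close>.\<close>

locale cell_averages =
  fixes g :: "real \<Rightarrow> real" and S :: "real set" and F :: "real \<Rightarrow> real"
  assumes g_mono: "mono_on {0..1} g" and g_range: "g ` {0..1} \<subseteq> {0..1}"
    and S_finite: "finite S" and S_subset: "S \<subseteq> {0..1}"
    and F_mono: "mono_on {0..1} F" and F_nonneg: "\<And>t. 0 \<le> F t"
    and F_le: "\<And>t. t \<in> {0..1} \<Longrightarrow> F t \<le> t"
begin

abbreviation "L \<equiv> card (S - {0})"

lemma S_nonneg: "S \<subseteq> {0..}"
  using S_subset by auto

lemma F_supp_pt:
  assumes "k \<le> L"
  shows "0 \<le> F (supp_pt S k)" "F (supp_pt S k) \<le> supp_pt S k" "F (supp_pt S k) \<le> 1"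
  using F_nonneg F_le[of "supp_pt S k"] supp_pt_mem_unit[OF S_finite S_subset assms] by auto

lemma F_supp_pt_mono:
  assumes "j \<le> k" "k \<le> L"
  shows "F (supp_pt S j) \<le> F (supp_pt S k)"
proof (rule mono_onD[OF F_mono])
  show "supp_pt S j \<in> {0..1}" "supp_pt S k \<in> {0..1}"
    using supp_pt_mem_unit[OF S_finite S_subset] assms by force+
  show "supp_pt S j \<le> supp_pt S k"
    using supp_pt_le[OF S_finite S_nonneg] assms by auto
qed

text \<open>The mean of a non-decreasing function over an interval lies between its endpoint values.
  On a degenerate cell the convention in \<open>cell_avg\<close> gives the common value; this
  includes \<open>k = 0\<close>, where \<open>k - 1\<close> is 0.\<close>

lemma cell_avg_bounds:
  assumes k: "k \<le> L"
  shows cell_avg_ge: "g (F (supp_pt S (k - 1))) \<le> cell_avg g S F k"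
    and cell_avg_le: "cell_avg g S F k \<le> g (F (supp_pt S k))"
    and cell_avg_mult: "(F (supp_pt S k) - F (supp_pt S (k - 1))) * cell_avg g S F k
          = integral {F (supp_pt S (k - 1))..F (supp_pt S k)} g"
proof -
  define a where "a = F (supp_pt S (k - 1))"
  define b where "b = F (supp_pt S k)"
  have ab: "0 \<le> a" "a \<le> b" "b \<le> 1"
    using F_supp_pt k F_supp_pt_mono[of "k - 1" k] by (auto simp: a_def b_def)
  have mon: "mono_on {a..b} g" using g_mono ab by (auto intro: mono_on_subset)
  have int: "g integrable_on {a..b}" by (rule integrable_on_mono_on[OF mon])
  have avg: "cell_avg g S F k = (if a = b then g b else (1 / (b - a)) * integral {a..b} g)"
    by (simp only: cell_avg_def a_def[symmetric] b_def[symmetric] set_integral_mono_on_eq[OF mon] Let_def)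
  have "integral {a..b} (\<lambda>_. g a) \<le> integral {a..b} g" "integral {a..b} g \<le> integral {a..b} (\<lambda>_. g b)"
    using ab by (intro integral_le int integrable_const_ivl mono_onD[OF mon]; simp)+
  then have bd: "(b - a) * g a \<le> integral {a..b} g" "integral {a..b} g \<le> (b - a) * g b"
    using ab by simp_all
  show "g (F (supp_pt S (k - 1))) \<le> cell_avg g S F k" "cell_avg g S F k \<le> g (F (supp_pt S k))"
    unfolding avg a_def[symmetric] b_def[symmetric]
    using bd ab by (auto simp: field_simps)
  show "(F (supp_pt S k) - F (supp_pt S (k - 1))) * cell_avg g S F k
          = integral {F (supp_pt S (k - 1))..F (supp_pt S k)} g"
    unfolding avg a_def[symmetric] b_def[symmetric] using ab by auto
qed

lemma g_unit:
  assumes "t \<in> {0..1}"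
  shows "0 \<le> g t" "g t \<le> 1"
  using g_range assms by (auto simp: image_subset_iff)

lemma cell_avg_nonneg:
  assumes "k \<le> L"
  shows "0 \<le> cell_avg g S F k"
proof -
  have "0 \<le> g (F (supp_pt S (k - 1)))"
    using F_supp_pt[of "k - 1"] assms by (intro g_unit) auto
  with cell_avg_ge[OF assms] show ?thesis by linarith
qed

text \<open>Adjacent cells share the endpoint \<open>F (supp_pt S k)\<close>, and the value of
  \<open>g\<close> there separates their averages.\<close>

lemma cell_avg_Suc:
  assumes "Suc k \<le> L"
  shows "cell_avg g S F k \<le> cell_avg g S F (Suc k)"
  using cell_avg_le[of k] cell_avg_ge[of "Suc k"] assms by auto

lemma S_cases:
  assumes "s \<in> S"
  obtains "s = 0" | k where "k \<in> {1..L}" "s = supp_pt S k"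
proof (cases "s = 0")
  case False
  then have "s \<in> supp_pt S ` {1..L}"
    using assms bij_betw_imp_surj_on[OF bij_betw_supp_pt[OF S_finite]] by blast
  then show ?thesis using that by blast
qed

lemmas g_bar_simps = g_bar_supp_pt[OF S_finite S_nonneg] g_bar_0[OF S_finite S_nonneg]

lemma g_bar_nonneg: "0 \<le> g_bar g S F t"
  unfolding g_bar_def by (intro sum_nonneg mult_nonneg_nonneg cell_avg_nonneg) auto

text \<open>A cell average is at most the value of \<open>g\<close> at the right end
  \<open>F (supp_pt S k)\<close>, and super-uniformity puts this end at or below
  \<open>supp_pt S k\<close>.\<close>

lemma g_bar_le:
  assumes "s \<in> S"
  shows "g_bar g S F s \<le> g s"
  using assms
proof (cases rule: S_cases)
  case 1
  then show ?thesis using g_unit[of 0] by (simp add: g_bar_simps)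
next
  case (2 k)
  have "cell_avg g S F k \<le> g (F (supp_pt S k))" using 2 by (intro cell_avg_le) auto
  also have "\<dots> \<le> g (supp_pt S k)"
    using F_supp_pt[of k] supp_pt_mem_unit[OF S_finite S_subset, of k] 2
    by (intro mono_onD[OF g_mono]) auto
  finally show ?thesis using 2 by (simp add: g_bar_simps)
qed

lemma g_bar_le_1:
  assumes "s \<in> S"
  shows "g_bar g S F s \<le> 1"
  using g_bar_le[OF assms] g_unit[of s] S_subset assms by auto

lemma cell_avg_mono:
  assumes "j \<le> k" "k \<le> L"
  shows "cell_avg g S F j \<le> cell_avg g S F k"
  using assms by (induction k rule: dec_induct) (auto intro: order_trans[OF _ cell_avg_Suc])

text \<open>The restriction to \<open>S\<close> matters: beyond the largest support point
  \<open>g_bar\<close> is 0.\<close>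

lemma g_bar_mono:
  assumes "s \<in> S" "t \<in> S" "s \<le> t"
  shows "g_bar g S F s \<le> g_bar g S F t"
  using assms(1)
proof (cases rule: S_cases)
  case 1
  then show ?thesis by (simp add: g_bar_simps g_bar_nonneg)
next
  case s: (2 j)
  show ?thesis using assms(2)
  proof (cases rule: S_cases)
    case 1
    then show ?thesis using s assms supp_pt_less[OF S_finite S_nonneg, of 0 j] by auto
  next
    case t: (2 k)
    then have "j \<le> k"
      using s assms supp_pt_less[OF S_finite S_nonneg, of k j] by force
    then show ?thesis using s t cell_avg_mono by (simp add: g_bar_simps)
  qed
qed

text \<open>The intervals between consecutive values of \<open>F\<close> at the support points tile
  the range of integration, starting from \<open>F 0 = 0\<close>.\<close>

lemma sum_cell_integrals:
  assumes "n \<le> L"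
  shows "(\<Sum>k = 1..n. (F (supp_pt S k) - F (supp_pt S (k - 1))) * cell_avg g S F k)
    = integral {0..F (supp_pt S n)} g"
  using assms
proof (induction n)
  case 0
  have "F 0 = 0" using F_nonneg[of 0] F_le[of 0] by auto
  then show ?case by simp
next
  case (Suc n)
  have "integral {0..F (supp_pt S n)} g + integral {F (supp_pt S n)..F (supp_pt S (Suc n))} g
      = integral {0..F (supp_pt S (Suc n))} g"
  proof (rule Henstock_Kurzweil_Integration.integral_combine)
    show "g integrable_on {0..F (supp_pt S (Suc n))}"
      using F_supp_pt[of "Suc n"] Suc.prems
      by (intro integrable_on_mono_on mono_on_subset[OF g_mono]) auto
  qed (use F_supp_pt[of n] F_supp_pt_mono[of n "Suc n"] Suc.prems in auto)
  then show ?case using Suc cell_avg_mult[of "Suc n"] by simp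
qed

text \<open>Summation by parts: the excess \<open>D\<close> of \<open>F\<close> over the distribution function of \<open>w\<close> is nonnegative and
  vanishes at both ends, and the cell averages are non-decreasing.\<close>

lemma nu_le_mean_g_bar:
  assumes w: "\<And>s. s \<in> S \<Longrightarrow> 0 \<le> w s" and w1: "(\<Sum>s\<in>S. w s) = 1"
    and wF: "\<And>t. t \<in> {0..1} \<Longrightarrow> (\<Sum>s\<in>{s \<in> S. s \<le> t}. w s) \<le> F t"
  shows "nu g \<le> (\<Sum>s\<in>S. w s * g_bar g S F s)"
proof -
  \<comment> \<open>\<open>Q\<close> is the distribution function of the weights \<open>w\<close> at
    the support points.\<close>
  define Q where "Q k = (\<Sum>s\<in>{s \<in> S. s \<le> supp_pt S k}. w s)" for k
  define D where "D k = F (supp_pt S k) - Q k" for k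
  define a where "a = cell_avg g S F"
  have D_nonneg: "0 \<le> D k" if "k \<le> L" for k
    using wF[of "supp_pt S k"] supp_pt_mem_unit[OF S_finite S_subset that]
    by (simp add: D_def Q_def)
  have D0: "D 0 = 0"
  proof -
    have "0 \<le> Q 0" unfolding Q_def by (intro sum_nonneg w) auto
    with D_nonneg[of 0] F_le[of 0] show ?thesis by (simp add: D_def)
  qed
  have QL: "Q L = 1"
  proof -
    have "s \<le> supp_pt S L" if "s \<in> S" for s
      using that
    proof (cases rule: S_cases)
      case 1
      then show ?thesis using supp_pt_nonneg[OF S_finite S_nonneg, of L] by simp
    next
      case (2 k)
      then show ?thesis using supp_pt_le[OF S_finite S_nonneg, of k L] by simp
    qed
    then have "{s \<in> S. s \<le> supp_pt S L} = S" by auto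
    then show ?thesis by (simp add: Q_def w1)
  qed
  \<comment> \<open>All mass of \<open>w\<close> lies at or below the last support point, so
    \<open>1 = Q L \<le> F (supp_pt S L) \<le> 1\<close>.\<close>
  have FL: "F (supp_pt S L) = 1" and DL: "D L = 0"
    using D_nonneg[of L] F_supp_pt(3)[of L] QL by (auto simp: D_def)
  have step: "w (supp_pt S (Suc k)) = Q (Suc k) - Q k" if "Suc k \<le> L" for k
  proof -
    have lt: "supp_pt S k < supp_pt S (Suc k)"
      using supp_pt_less[OF S_finite S_nonneg, of k "Suc k"] that by simp
    have mem: "supp_pt S (Suc k) \<in> S"
      using bij_betwE[OF bij_betw_supp_pt[OF S_finite]] that by auto
    \<comment> \<open>No point of \<open>S\<close> lies strictly between consecutive support points,
      so \<open>Q\<close> gains exactly one weight.\<close>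
    have "s \<le> supp_pt S (Suc k) \<longleftrightarrow> s = supp_pt S (Suc k) \<or> s \<le> supp_pt S k" if "s \<in> S" for s
      using that
    proof (cases rule: S_cases)
      case 1
      then show ?thesis
        using lt supp_pt_nonneg[OF S_finite S_nonneg, of k] \<open>Suc k \<le> L\<close> by auto
    next
      case (2 j)
      then show ?thesis
        using lt supp_pt_le[OF S_finite S_nonneg, of j k] supp_pt_less[OF S_finite S_nonneg, of "Suc k" j]
          \<open>Suc k \<le> L\<close> by (cases j "Suc k" rule: linorder_cases) auto
    qed
    then have "{s \<in> S. s \<le> supp_pt S (Suc k)} = insert (supp_pt S (Suc k)) {s \<in> S. s \<le> supp_pt S k}"
      using mem by auto
    then show ?thesis using lt S_finite by (simp add: Q_def)
  qed
  \<comment> \<open>Abel summation as an inequality: since \<open>D n\<close> is nonnegative, its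
    coefficient \<open>a n\<close> may be raised to \<open>a (Suc n)\<close>.\<close>
  have parts: "(\<Sum>k = 1..n. a k * (D k - D (k - 1))) \<le> a n * D n" if "n \<le> L" for n
    using that
  proof (induction n)
    case (Suc n)
    have "a n * D n \<le> a (Suc n) * D n"
      using Suc.prems D_nonneg cell_avg_Suc by (intro mult_right_mono) (auto simp: a_def)
    with Suc show ?case by (simp add: algebra_simps)
  qed (simp add: D0)
  have "(\<Sum>s\<in>S. w s * g_bar g S F s) = (\<Sum>s\<in>S - {0}. w s * g_bar g S F s)"
    using S_finite by (intro sum.mono_neutral_right) (auto simp: g_bar_simps)
  also have "\<dots> = (\<Sum>k = 1..L. w (supp_pt S k) * g_bar g S F (supp_pt S k))"
    by (rule sum.reindex_bij_betw[OF bij_betw_supp_pt[OF S_finite], symmetric])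
  also have "\<dots> = (\<Sum>k = 1..L. (F (supp_pt S k) - F (supp_pt S (k - 1))) * a k - a k * (D k - D (k - 1)))"
  proof (rule sum.cong)
    fix k assume k: "k \<in> {1..L}"
    then have w_eq: "w (supp_pt S k) = Q k - Q (k - 1)" using step[of "k - 1"] by auto
    show "w (supp_pt S k) * g_bar g S F (supp_pt S k)
        = (F (supp_pt S k) - F (supp_pt S (k - 1))) * a k - a k * (D k - D (k - 1))"
      unfolding g_bar_simps(1)[OF k] w_eq a_def D_def by (simp add: algebra_simps)
  qed simp
  also have "\<dots> = integral {0..1} g - (\<Sum>k = 1..L. a k * (D k - D (k - 1)))"
    using sum_cell_integrals[of L] by (simp add: sum_subtractf a_def FL)
  \<comment> \<open>Since \<open>D L = 0\<close>, the subtracted sum is at most 0.\<close>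
  finally show ?thesis using parts[of L] DL nu_eq_integral[OF g_mono] by simp
qed

end

section \<open>Laws of the p-values\<close>

text \<open>No measurability of \<open>f\<close> is needed: a non-integrable function has integral 0.\<close>

lemma (in prob_space) integral_le_prod_mean:
  fixes X :: "'i \<Rightarrow> 'a \<Rightarrow> real"
  assumes indep: "indep_vars (\<lambda>_. borel) X I"
    and I: "finite I" and S: "\<And>i. i \<in> I \<Longrightarrow> finite (S i)"
    and supp: "\<And>i. i \<in> I \<Longrightarrow> AE x in M. X i x \<in> S i"
    and h: "\<And>q. q \<in> PiE I S \<Longrightarrow> 0 \<le> h q"
    and f: "\<And>x. x \<in> space M \<Longrightarrow> f x \<le> h (\<lambda>i\<in>I. X i x)"
  shows "(\<integral>x. f x \<partial>M) \<le> prod_mean I S (\<lambda>i s. prob (X i -` {s} \<inter> space M)) h"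
proof (cases "integrable M f")
  case False
  have "0 \<le> prod_mean I S (\<lambda>i s. prob (X i -` {s} \<inter> space M)) h"
    unfolding prod_mean_def by (intro sum_nonneg mult_nonneg_nonneg prod_nonneg h) auto
  with False show ?thesis by (simp add: not_integrable_integral_eq)
next
  case True
  define B where "B q = {x \<in> space M. \<forall>i\<in>I. X i x = q i}" for q
  have meas: "X i \<in> borel_measurable M" if "i \<in> I" for i
    using indep that by (auto simp: indep_vars_def)
  have B_sets [measurable]: "B q \<in> sets M" for q
    unfolding B_def
  proof (rule sets.sets_Collect_finite_All[OF _ I])
    fix i assume "i \<in> I"
    then have [measurable]: "X i \<in> borel_measurable M" by (rule meas)
    show "{x \<in> space M. X i x = q i} \<in> sets M" by measurable
  qed
  have prob_B: "prob (B q) = (\<Prod>i\<in>I. prob (X i -` {q i} \<inter> space M))" for q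
  \<comment> \<open>An empty intersection would be the whole type instead of
    \<open>space M\<close>.\<close>
  proof (cases "I = {}")
    case True
    then show ?thesis by (simp add: B_def prob_space)
  next
    case False
    have "B q = (\<Inter>i\<in>I. X i -` {q i} \<inter> space M)"
      using False by (auto simp: B_def)
    then show ?thesis using indep_varsD_finite[OF indep False I, of "\<lambda>i. {q i}"] by simp
  qed
  have fin: "finite (PiE I S)" using I S by (rule finite_PiE)
  have "AE x in M. \<forall>i\<in>I. X i x \<in> S i"
    using I supp by (rule AE_finite_allI)
  with AE_space have bound: "AE x in M. f x \<le> (\<Sum>q\<in>PiE I S. h q * indicator (B q) x)"
  proof eventually_elim
    case (elim x)
    define r where "r = (\<lambda>i\<in>I. X i x)"
    have r: "r \<in> PiE I S" using elim by (auto simp: r_def)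
    \<comment> \<open>Members of \<open>PiE\<close> are determined by their values on
      \<open>I\<close>, so exactly one indicator is 1 and the sum collapses to
      \<open>h r\<close>.\<close>
    have "x \<in> B q \<longleftrightarrow> q = r" if "q \<in> PiE I S" for q
      using elim(1) that by (auto simp: B_def r_def PiE_iff extensional_def)
    then have "(\<Sum>q\<in>PiE I S. h q * indicator (B q) x) = (\<Sum>q\<in>PiE I S. if q = r then h q else 0)"
      by (intro sum.cong) (auto simp: indicator_def)
    then show ?case using f[OF elim(1)] fin r by (simp add: r_def[symmetric])
  qed
  have "(\<integral>x. f x \<partial>M) \<le> (\<integral>x. (\<Sum>q\<in>PiE I S. h q * indicator (B q) x) \<partial>M)"
    by (rule integral_mono_AE[OF True _ bound])
       (auto intro!: Bochner_Integration.integrable_sum integrable_mult_right simp: emeasure_eq_measure)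
  also have "\<dots> = (\<Sum>q\<in>PiE I S. h q * prob (B q))"
    by (subst Bochner_Integration.integral_sum) (auto simp: emeasure_eq_measure)
  finally show ?thesis by (simp add: prod_mean_def prob_B mult.commute)
qed

lemma (in prob_space) sum_prob_vimage_singleton:
  assumes "X \<in> borel_measurable M" "finite A"
  shows "(\<Sum>s\<in>A. prob (X -` {s} \<inter> space M)) = prob {x \<in> space M. X x \<in> (A :: real set)}"
proof -
  have "prob (\<Union>s\<in>A. X -` {s} \<inter> space M) = (\<Sum>s\<in>A. prob (X -` {s} \<inter> space M))"
    using assms by (intro finite_measure_finite_Union) (auto simp: disjoint_family_on_def)
  moreover have "(\<Union>s\<in>A. X -` {s} \<inter> space M) = {x \<in> space M. X x \<in> A}" by auto
  ultimately show ?thesis by simp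
qed

section \<open>Null distribution functions as suprema of probabilities\<close>

lemma null_cdf_nonneg: "0 \<le> null_cdf m \<P> H p i t"
  by (simp add: null_cdf_def)

context
  fixes \<P> :: "'x measure set" and p :: "nat \<Rightarrow> 'x \<Rightarrow> real" and i :: nat
  assumes prob: "\<And>P. P \<in> \<P> \<Longrightarrow> prob_space P"
    and meas: "\<And>P. P \<in> \<P> \<Longrightarrow> p i \<in> borel_measurable P"
begin

text \<open>\<open>enn2real\<close> sends \<open>\<top>\<close> to 0, so its monotonicity requires a
  finite upper value. The supremum of probabilities is at most 1.\<close>

lemma null_cdf_finite:
  "(SUP P \<in> {P \<in> \<P>. i \<in> true_nulls m H P}. emeasure P {x \<in> space P. p i x \<le> t}) < \<top>"
proof -
  have "(SUP P \<in> {P \<in> \<P>. i \<in> true_nulls m H P}. emeasure P {x \<in> space P. p i x \<le> t}) \<le> 1"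
    using prob by (auto intro!: SUP_least prob_space.emeasure_le_1)
  then show ?thesis by (rule le_less_trans) simp
qed

lemma null_cdf_mono:
  assumes "s \<le> t"
  shows "null_cdf m \<P> H p i s \<le> null_cdf m \<P> H p i t"
  unfolding null_cdf_def
proof (rule enn2real_mono[OF _ null_cdf_finite], rule SUP_subset_mono)
  fix P assume "P \<in> {P \<in> \<P>. i \<in> true_nulls m H P}"
  then have [measurable]: "p i \<in> borel_measurable P" using meas by simp
  show "emeasure P {x \<in> space P. p i x \<le> s} \<le> emeasure P {x \<in> space P. p i x \<le> t}"
    using assms by (intro emeasure_mono) auto
qed simp

lemma null_prob_le_null_cdf:
  assumes "P \<in> \<P>" "i \<in> true_nulls m H P"
  shows "measure P {x \<in> space P. p i x \<le> t} \<le> null_cdf m \<P> H p i t"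
  unfolding null_cdf_def measure_def
  using assms by (intro enn2real_mono null_cdf_finite SUP_upper) auto

end

section \<open>Assembling the FDR bound and the comparison of the estimators\<close>

lemma m0_hat_mean_cong:
  assumes "\<And>i. i \<in> {1..m} \<Longrightarrow> q i = q' i"
  shows "m0_hat_mean m g S F q = m0_hat_mean m g S F q'"
  unfolding m0_hat_mean_def using assms by (intro arg_cong2[where f="(*)"] arg_cong2[where f="(+)"] sum.cong) auto

theorem proposition3p2:
  fixes M :: "'x measure"
    and \<P> :: "'x measure set"
    and H :: "nat \<Rightarrow> 'x measure set"
    and m :: nat
    and p :: "nat \<Rightarrow> 'x \<Rightarrow> real"
    and S :: "nat \<Rightarrow> real set"
    and g :: "real \<Rightarrow> real"
    and \<alpha> :: real
  assumes model: "\<And>P. P \<in> \<P> \<Longrightarrow> prob_space P \<and> sets P = sets M"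
    and pval_measurable: "\<And>i. i \<in> {1..m} \<Longrightarrow> p i \<in> borel_measurable M"
    and pval_range: "\<And>i x. i \<in> {1..m} \<Longrightarrow> x \<in> space M \<Longrightarrow> p i x \<in> {0..1}"
    and independence: "\<And>P. P \<in> \<P> \<Longrightarrow> prob_space.indep_vars P (\<lambda>_. borel) p {1..m}"
    and support_finite: "\<And>i. i \<in> {1..m} \<Longrightarrow> finite (S i) \<and> S i \<subseteq> {0..1}"
    and support: "\<And>i P. i \<in> {1..m} \<Longrightarrow> P \<in> \<P> \<Longrightarrow> (AE x in P. p i x \<in> S i)"
    and discrete: "\<And>i. i \<in> {1..m} \<Longrightarrow> right_cont_step_on (S i) (null_cdf m \<P> H p i)"
    and super_uniform:
      "\<And>i t. i \<in> {1..m} \<Longrightarrow> t \<in> {0..1} \<Longrightarrow> null_cdf m \<P> H p i t \<le> t"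
    and g: "g \<in> G_class"
    and level: "0 \<le> \<alpha>"
  shows "(\<forall>P\<in>\<P>. FDR m H p (plug_in_BH m \<alpha> (m0_hat_mean m g S (null_cdf m \<P> H p))) P \<le> \<alpha>) \<and>
         (\<forall>P\<in>\<P>. AE x in P. m0_hat_mean m g S (null_cdf m \<P> H p) (\<lambda>i. p i x)
                             \<le> m0_hat m g (\<lambda>i. p i x))"
proof -
  define F where "F = null_cdf m \<P> H p"
  define \<mu> where "\<mu> = m0_hat_mean m g S F"
  have p_meas: "p i \<in> borel_measurable P" if "i \<in> {1..m}" "P \<in> \<P>" for i P
    using pval_measurable[OF that(1)] model[OF that(2)] measurable_cong_sets by blast
  have cells: "cell_averages g (S i) (F i)" if i: "i \<in> {1..m}" for i
  proof
    show "mono_on {0..1} g" "g ` {0..1} \<subseteq> {0..1}" using g by (auto simp: G_class_def)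
    show "finite (S i)" "S i \<subseteq> {0..1}" using support_finite[OF i] by auto
    show "mono_on {0..1} (F i)"
      unfolding F_def using model p_meas[OF i] by (intro mono_onI null_cdf_mono) auto
    show "0 \<le> F i t" for t by (simp add: F_def null_cdf_nonneg)
    show "F i t \<le> t" if "t \<in> {0..1}" for t using super_uniform[OF i that] by (simp add: F_def)
  qed
  have nu: "0 < nu g" using g by (simp add: G_class_def)
  have \<mu>_mono: "\<mu> q \<le> \<mu> q'"
    if "\<And>i. i \<in> {1..m} \<Longrightarrow> q i \<in> S i \<and> q' i \<in> S i \<and> q i \<le> q' i" for q q'
    unfolding \<mu>_def m0_hat_mean_def
    using nu that by (intro mult_left_mono add_left_mono sum_mono cell_averages.g_bar_mono[OF cells]) auto
  have \<mu>_pos: "0 < \<mu> q" for q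
    unfolding \<mu>_def m0_hat_mean_def
    using nu by (intro mult_pos_pos add_pos_nonneg sum_nonneg cell_averages.g_bar_nonneg[OF cells]) auto
  have FDR_le: "FDR m H p (plug_in_BH m \<alpha> \<mu>) P \<le> \<alpha>" if P: "P \<in> \<P>" for P
  proof -
    interpret prob_space P using model[OF P] by simp
    define N where "N = true_nulls m H P"
    have N: "N \<subseteq> {1..m}" "finite N" by (auto simp: N_def true_nulls_def)
    define w where "w i s = prob (p i -` {s} \<inter> space P)" for i s
    define h where "h q = (\<Sum>i\<in>N. if q i \<le> real (BH_count m \<alpha> \<mu> q) * \<alpha> / \<mu> q
      then 1 / real (BH_count m \<alpha> \<mu> q) else 0)" for q
    have w_sum1: "(\<Sum>s\<in>S i. w i s) = 1" if i: "i \<in> {1..m}" for i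
      unfolding w_def sum_prob_vimage_singleton[OF p_meas[OF i P] support_finite[OF i, THEN conjunct1]]
      using support[OF i P] p_meas[OF i P] support_finite[OF i]
      by (subst prob_Collect_eq_1) (auto intro!: predE pred_sets2[where N=borel] borel_closed finite_imp_closed)
    \<comment> \<open>For a true null, \<open>P\<close> is one of the laws in the supremum defining
      \<open>F i\<close>.\<close>
    have w_cdf: "(\<Sum>s\<in>{s \<in> S i. s \<le> t}. w i s) \<le> F i t" if i: "i \<in> N" for i t
    proof -
      have im: "i \<in> {1..m}" using i N by auto
      have "(\<Sum>s\<in>{s \<in> S i. s \<le> t}. w i s) = prob {x \<in> space P. p i x \<in> {s \<in> S i. s \<le> t}}"
        unfolding w_def using support_finite[OF im] by (intro sum_prob_vimage_singleton p_meas im P) auto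
      also have "\<dots> \<le> prob {x \<in> space P. p i x \<le> t}"
        using p_meas[OF im P] by (intro finite_measure_mono) auto
      also have "\<dots> \<le> F i t"
        unfolding F_def using model p_meas[OF im] i P by (intro null_prob_le_null_cdf) (auto simp: N_def)
      finally show ?thesis .
    qed
    \<comment> \<open>Points of the finite product are \<open>undefined\<close> off
      \<open>{1..m}\<close>, so \<open>h\<close> must depend on the coordinates in
      \<open>{1..m}\<close> only.\<close>
    have h_cong: "h q = h q'" if eq: "\<And>i. i \<in> {1..m} \<Longrightarrow> q i = q' i" for q q'
    proof -
      have \<mu>_eq: "\<mu> q = \<mu> q'" unfolding \<mu>_def using eq by (rule m0_hat_mean_cong)
      have "BH_count m \<alpha> \<mu> q = BH_count m \<alpha> \<mu> q'" using \<mu>_eq eq by (rule BH_count_cong)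
      then show ?thesis unfolding h_def using \<mu>_eq eq N by (intro sum.cong) auto
    qed
    have "FDR m H p (plug_in_BH m \<alpha> \<mu>) P \<le> prod_mean {1..m} S w h"
      unfolding FDR_def w_def N_def[symmetric]
    proof (rule integral_le_prod_mean[OF independence[OF P]])
      fix x
      have "FDP N (plug_in_BH m \<alpha> \<mu> (\<lambda>i. p i x)) \<le> h (\<lambda>i. p i x)"
        unfolding h_def using N(2) by (rule FDP_plug_in_BH_le)
      also have "\<dots> = h (\<lambda>i\<in>{1..m}. p i x)" by (rule h_cong) simp
      finally show "FDP N (plug_in_BH m \<alpha> \<mu> (\<lambda>i. p i x)) \<le> h (\<lambda>i\<in>{1..m}. p i x)" .
    qed (use support_finite support P in \<open>auto simp: h_def intro!: sum_nonneg\<close>)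
    also have "\<dots> \<le> \<alpha>"
      unfolding h_def
    proof (rule prod_mean_plug_in_le[where Y = "\<lambda>i. g_bar g (S i) (F i)" and \<nu> = "nu g"])
      show "(\<Sum>s\<in>{s \<in> S i. s \<le> t}. w i s) \<le> t" if "i \<in> N" "t \<in> {0..1}" for i t
        using w_cdf[OF that(1), of t] super_uniform[of i t] that N by (auto simp: F_def)
      show "nu g \<le> (\<Sum>s\<in>S i. w i s * g_bar g (S i) (F i) s)" if i: "i \<in> N" for i
      proof (rule cell_averages.nu_le_mean_g_bar)
        show "cell_averages g (S i) (F i)" "(\<Sum>s\<in>S i. w i s) = 1"
          using i N by (auto intro!: cells w_sum1)
      qed (auto simp: w_def w_cdf[OF i, unfolded w_def])
      \<comment> \<open>Raising one p-value within its support cannot lower the estimate, because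
        \<open>g_bar\<close> is non-decreasing there. Both effects can only reduce the
        count.\<close>
      show "BH_count m \<alpha> \<mu> (q(i := t)) \<le> BH_count m \<alpha> \<mu> (q(i := s))"
        if "q \<in> PiE {1..m} S" "i \<in> N" "s \<in> S i" "t \<in> S i" "s \<le> t" for q i s t
        using that level \<mu>_pos by (intro BH_count_antimono \<mu>_mono) (auto simp: PiE_iff)
    qed (use N support_finite w_sum1 level nu cells in
        \<open>auto simp: w_def \<mu>_def m0_hat_mean_def
          intro!: cell_averages.g_bar_nonneg cell_averages.g_bar_le_1\<close>)
    finally show ?thesis .
  qed
  have "AE x in P. \<mu> (\<lambda>i. p i x) \<le> m0_hat m g (\<lambda>i. p i x)" if P: "P \<in> \<P>" for P
  proof -
    \<comment> \<open>The comparison \<open>g_bar_le\<close> holds at support points, which is why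
      the inequality is almost sure.\<close>
    have "AE x in P. \<forall>i\<in>{1..m}. p i x \<in> S i"
      using support[OF _ P] by (intro AE_finite_allI) auto
    then show ?thesis
    proof eventually_elim
      case (elim x)
      then show ?case
        unfolding \<mu>_def m0_hat_mean_def m0_hat_def
        using nu by (intro mult_left_mono add_left_mono sum_mono cell_averages.g_bar_le[OF cells]) auto
    qed
  qed
  with FDR_le show ?thesis unfolding \<mu>_def F_def by blast
qed

end
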